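(* For positive integers $d$ and $k$, let $v_{k,d}$ be the number of vertices of the flow polytope $\mathcal F_{G(k,d+k)}$. Then $v_{k,d}=d+1$ for $d=1,\dots,k$, and $v_{k,d}=v_{k,d-1}+v_{k,d-k}$ for $d>k$. Moreover, for each $k\ge1$, $$\sum_{d\ge1}v_{k,d}\,x^d=\frac{x\,(2+x+x^2+\cdots+x^{k-1})}{1-x-x^k}$$ as formal power series, where the factor in the numerator is $2+\sum_{i=1}^{k-1}x^i$.
   Context: The distance graph $G(k,d+k)$ is the directed multigraph with vertex set $\{1,\dots,d+k\}$ and $2d+k-1$ edges: $(i,i+1)$ for $1\le i\le d+k-1$, and $(i,i+k)$ for $1\le i\le d$ (for $k=1$ every edge $(i,i+1)$ appears twice). For a directed graph $G$ on $\{1,\dots,m\}$, the flow polytope $\mathcal F_G\subset\mathbb R^{E(G)}$ is the set of tuples $(f_e)_{e\in E(G)}$ of nonnegative reals such that at every vertex $i$, (sum of $f_e$ over edges leaving $i$) minus (sum of $f_e$ over edges entering $i$) equals $1$ if $i=1$, $-1$ if $i=m$, and $0$ otherwise. *)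

theory Defs
  imports
    "HOL-Analysis.Polytope"
    "HOL-Analysis.Finite_Function_Topology"
    "HOL-Computational_Algebra.Formal_Power_Series"
    "Graph_Theory.Digraph"
begin

text \<open>
  The edge \<open>(i, i + 1)\<close> is \<open>Short i\<close> and the edge \<open>(i, i + k)\<close> is \<open>Long i\<close>. The two families stay
  disjoint as arc names, so for \<open>k = 1\<close> they give parallel edges.
\<close>

datatype dist_arc = Short nat | Long nat

definition distance_graph :: "nat \<Rightarrow> nat \<Rightarrow> (nat, dist_arc) pre_digraph" where
  "distance_graph k n =
    \<lparr> verts = {1..n},
      arcs = Short ` {1..n - 1} \<union> Long ` {1..n - k},
      tail = (\<lambda>e. case e of Short i \<Rightarrow> i | Long i \<Rightarrow> i),
      head = (\<lambda>e. case e of Short i \<Rightarrow> i + 1 | Long i \<Rightarrow> i + k) \<rparr>"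

text \<open>
  For a finite digraph \<open>G\<close> on the vertex set \<open>{1..m}\<close>, so that \<open>m = card (verts G)\<close>.
  The space of real tuples indexed by \<open>arcs G\<close> is the subspace of
  those finitely supported functions whose support lies in \<open>arcs G\<close>.
\<close>

definition flow_polytope :: "(nat, 'e) pre_digraph \<Rightarrow> ('e \<Rightarrow>\<^sub>0 real) set" where
  "flow_polytope G =
    {f. Poly_Mapping.keys f \<subseteq> arcs G \<and>
        (\<forall>e \<in> arcs G. 0 \<le> Poly_Mapping.lookup f e) \<and>
        (\<forall>i \<in> verts G.
          (\<Sum>e \<in> out_arcs G i. Poly_Mapping.lookup f e)
            - (\<Sum>e \<in> in_arcs G i. Poly_Mapping.lookup f e)
          = (if i = 1 then 1 else if i = card (verts G) then - 1 else 0))}"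

definition num_vertices :: "nat \<Rightarrow> nat \<Rightarrow> nat" where
  "num_vertices k d = card {f. f extreme_point_of flow_polytope (distance_graph k (d + k))}"

end

theory Submission
  imports Defs
begin

text \<open>
  The vertices are the indicator flows of the directed paths from the first to the last vertex.
  A flow in the polytope contains such a path in its support, and a small multiple of the path's
  indicator can be split off as a convex summand; hence an extreme flow is a path indicator.
  Conversely, a path indicator is the only flow supported on its path, so it is extreme.
  Counting paths by their last arc gives the recursion, and with it the generating function.
\<close>

section \<open>Directed paths from vertex 1 and their net flow\<close>

text \<open>For positive \<open>k\<close> every arc increases the vertex label, so the set of arcs
  already determines the order in which a path runs through them.\<close>

inductive dist_path :: "nat \<Rightarrow> nat \<Rightarrow> dist_arc set \<Rightarrow> bool" for k :: nat where
  start: "dist_path k 1 {}"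
| short: "dist_path k i p \<Longrightarrow> dist_path k (i + 1) (insert (Short i) p)"
| long: "dist_path k i p \<Longrightarrow> dist_path k (i + k) (insert (Long i) p)"

lemma dist_path_bounds:
  assumes "dist_path k n p" "k \<ge> 1"
  shows "1 \<le> n" "finite p"
    "Short i \<in> p \<Longrightarrow> 1 \<le> i \<and> i < n" "Long i \<in> p \<Longrightarrow> 1 \<le> i \<and> i + k \<le> n"
proof -
  from assms(1) have "1 \<le> n \<and> finite p \<and> (\<forall>i. Short i \<in> p \<longrightarrow> 1 \<le> i \<and> i < n) \<and>
      (\<forall>i. Long i \<in> p \<longrightarrow> 1 \<le> i \<and> i + k \<le> n)"
  proof induction
    case (short i p)
    then show ?case by fastforce
  next
    case (long i p)
    then show ?case using assms(2) by fastforce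
  qed auto
  then show "1 \<le> n" "finite p"
    "Short i \<in> p \<Longrightarrow> 1 \<le> i \<and> i < n" "Long i \<in> p \<Longrightarrow> 1 \<le> i \<and> i + k \<le> n"
    by auto
qed

lemma arcs_distance_graph:
  "Short i \<in> arcs (distance_graph k n) \<longleftrightarrow> 1 \<le> i \<and> i < n"
  "Long i \<in> arcs (distance_graph k n) \<longleftrightarrow> 1 \<le> i \<and> i + k \<le> n"
  by (auto simp: distance_graph_def)

lemma dist_path_subset_arcs:
  assumes "dist_path k n p" "k \<ge> 1"
  shows "p \<subseteq> arcs (distance_graph k n)"
proof
  fix e assume "e \<in> p"
  then show "e \<in> arcs (distance_graph k n)"
    using dist_path_bounds[OF assms] by (cases e) (auto simp: arcs_distance_graph)
qed

text \<open>
  The truncated subtractions are harmless: \<open>Short 0\<close> and \<open>Long 0\<close> are never arcs, so flows vanish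
  on them.
\<close>

definition net_flow :: "nat \<Rightarrow> (dist_arc \<Rightarrow> real) \<Rightarrow> nat \<Rightarrow> real" where
  "net_flow k f i = f (Short i) + f (Long i) - (f (Short (i - 1)) + f (Long (i - k)))"

lemma flow_polytope_distance_graph_iff:
  assumes "k \<ge> 1"
  shows "f \<in> flow_polytope (distance_graph k n) \<longleftrightarrow>
    Poly_Mapping.keys f \<subseteq> arcs (distance_graph k n) \<and>
    (\<forall>e. 0 \<le> Poly_Mapping.lookup f e) \<and>
    (\<forall>i \<in> {1..n}. net_flow k (Poly_Mapping.lookup f) i = (if i = 1 then 1 else if i = n then - 1 else 0))"
proof (cases "Poly_Mapping.keys f \<subseteq> arcs (distance_graph k n)")
  case True
  let ?G = "distance_graph k n" and ?f = "Poly_Mapping.lookup f"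
  have zero: "?f e = 0" if "e \<notin> arcs ?G" for e
    using that True by (meson in_keys_iff subsetD)
  have "(\<Sum>e \<in> out_arcs ?G i. ?f e) - (\<Sum>e \<in> in_arcs ?G i. ?f e) = net_flow k ?f i"
    if "i \<in> {1..n}" for i
  proof -
    have "out_arcs ?G i = arcs ?G \<inter> {Short i, Long i}"
      by (auto simp: out_arcs_def distance_graph_def)
    then have out_sum: "(\<Sum>e \<in> out_arcs ?G i. ?f e) = (\<Sum>e \<in> {Short i, Long i}. ?f e)"
      using zero by (intro sum.mono_neutral_left) auto
    have "in_arcs ?G i = arcs ?G \<inter> {Short (i - 1), Long (i - k)}"
      using that by (auto simp: in_arcs_def distance_graph_def)
    then have in_sum: "(\<Sum>e \<in> in_arcs ?G i. ?f e) = (\<Sum>e \<in> {Short (i - 1), Long (i - k)}. ?f e)"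
      using zero by (intro sum.mono_neutral_left) auto
    show ?thesis unfolding out_sum in_sum by (simp add: net_flow_def)
  qed
  moreover have "(\<forall>e \<in> arcs ?G. 0 \<le> ?f e) \<longleftrightarrow> (\<forall>e. 0 \<le> ?f e)"
    using zero by (metis order_refl)
  moreover have "verts ?G = {1..n}"
    by (simp add: distance_graph_def)
  ultimately show ?thesis
    using True unfolding flow_polytope_def by simp
qed (simp add: flow_polytope_def)

text \<open>Appending an arc moves the sink from its tail to its head and changes the net flow
  nowhere else. The difference of two \<open>of_bool\<close> terms also fits the empty path, where
  source and sink cancel.\<close>

lemma net_flow_indicator:
  assumes "dist_path k n p" "k \<ge> 1" "i \<ge> 1"
  shows "net_flow k (indicator p) i = of_bool (i = 1) - of_bool (i = n)"
  using assms(1)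
proof induction
  case start
  then show ?case by (simp add: net_flow_def)
next
  case (short j p)
  note b = dist_path_bounds[OF short(1) assms(2)]
  have "Short j \<notin> p" using b(3) by blast
  then have "net_flow k (indicator (insert (Short j) p)) i
      = net_flow k (indicator p) i + of_bool (i = j) - of_bool (i = j + 1)"
    using b(1) assms(3) by (auto simp: net_flow_def indicator_def)
  then show ?case using short.IH by simp
next
  case (long j p)
  note b = dist_path_bounds[OF long(1) assms(2)]
  have "Long j \<notin> p" using b(4)[of j] assms(2) by auto
  then have "net_flow k (indicator (insert (Long j) p)) i
      = net_flow k (indicator p) i + of_bool (i = j) - of_bool (i = j + k)"
    using b(1) assms(2) by (auto simp: net_flow_def indicator_def)
  then show ?case using long.IH by simp
qed

section \<open>Paths inside the support of a flow, and rigidity of flows on a path\<close>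

text \<open>Walk backwards: positive inflow at \<open>j\<close> comes through an arc carrying flow,
  and conservation makes the inflow at its tail positive too, unless that tail is 1. Labels
  decrease, so the walk ends at 1.\<close>

lemma dist_path_in_support:
  fixes f :: "dist_arc \<Rightarrow> real"
  assumes k: "k \<ge> 1" and nonneg: "\<And>e. 0 \<le> f e"
    and supp: "\<And>e. f e \<noteq> 0 \<Longrightarrow> e \<in> arcs (distance_graph k n)"
    and conserve: "\<And>i. 1 < i \<Longrightarrow> i < n \<Longrightarrow> net_flow k f i = 0"
    and "1 \<le> j" "j \<le> n" "j = 1 \<or> 0 < f (Short (j - 1)) + f (Long (j - k))"
  shows "\<exists>p. dist_path k j p \<and> (\<forall>e \<in> p. 0 < f e)"
  using assms(5-7)
proof (induction j rule: less_induct)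
  case (less j)
  have inflow: "i = 1 \<or> 0 < f (Short (i - 1)) + f (Long (i - k))"
    if "1 \<le> i" "i < j" "0 < f (Short i) + f (Long i)" for i
    using conserve[of i] that less.prems(2) by (cases "i = 1") (auto simp: net_flow_def)
  consider "j = 1" | "j > 1" "f (Short (j - 1)) \<noteq> 0" | "j > 1" "f (Long (j - k)) \<noteq> 0"
    using less.prems by fastforce
  then show ?case
  proof cases
    case 1
    then show ?thesis using dist_path.start by auto
  next
    case 2
    let ?i = "j - 1"
    have pos: "0 < f (Short ?i)" using 2(2) nonneg[of "Short ?i"] by linarith
    have "1 \<le> ?i" "?i < j" "?i \<le> n" using 2(1) less.prems by auto
    moreover have "0 < f (Short ?i) + f (Long ?i)" using pos nonneg[of "Long ?i"] by linarith
    ultimately obtain p where "dist_path k ?i p" "\<forall>e \<in> p. 0 < f e"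
      using less.IH[of ?i] inflow[of ?i] by auto
    then show ?thesis
      using dist_path.short[of k ?i p] pos 2(1) by (intro exI[of _ "insert (Short ?i) p"]) auto
  next
    case 3
    let ?i = "j - k"
    have pos: "0 < f (Long ?i)" using 3(2) nonneg[of "Long ?i"] by linarith
    \<comment> \<open>The support hypothesis excludes \<open>Long 0\<close>, so \<open>j - k\<close>
      is not truncated.\<close>
    have "1 \<le> ?i" using supp[OF 3(2)] by (simp add: arcs_distance_graph)
    then have i: "1 \<le> ?i" "?i < j" "?i \<le> n" "?i + k = j" using k less.prems by auto
    moreover have "0 < f (Short ?i) + f (Long ?i)" using pos nonneg[of "Short ?i"] by linarith
    ultimately obtain p where "dist_path k ?i p" "\<forall>e \<in> p. 0 < f e"
      using less.IH[of ?i] inflow[of ?i] by auto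
    then show ?thesis
      using dist_path.long[of k ?i p] pos i(4) by (intro exI[of _ "insert (Long ?i) p"]) auto
  qed
qed

text \<open>The unit entering the endpoint \<open>j\<close> must use the last arc of the path, and
  conservation hands it on to the previous vertex. Allowing arbitrary flow on arcs with tail at
  least \<open>j\<close> lets the induction hypothesis survive the removal of the last arc.\<close>

lemma flow_on_dist_path:
  fixes f :: "dist_arc \<Rightarrow> real"
  assumes "dist_path k j p" and k: "k \<ge> 1" and "j \<le> n"
    and conserve: "\<And>i. 1 < i \<Longrightarrow> i < n \<Longrightarrow> net_flow k f i = 0"
    and "j = 1 \<or> f (Short (j - 1)) + f (Long (j - k)) = 1"
    and "\<And>i. f (Short i) \<noteq> 0 \<Longrightarrow> Short i \<in> p \<or> j \<le> i"
    and "\<And>i. f (Long i) \<noteq> 0 \<Longrightarrow> Long i \<in> p \<or> j \<le> i"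
    and "e \<in> p"
  shows "f e = 1"
  using assms(1,3,5-8)
proof (induction arbitrary: e)
  case start
  then show ?case by simp
next
  case (short j p)
  note b = dist_path_bounds[OF short.hyps k]
  \<comment> \<open>The competing arc into \<open>j + 1\<close> has its tail before
    \<open>j + 1\<close> and cannot lie on \<open>p\<close>, whose arcs end at \<open>j\<close> or
    earlier.\<close>
  have "f (Long (j + 1 - k)) = 0"
    using short.prems(4)[of "j + 1 - k"] b(1) b(4)[of "j + 1 - k"] k by fastforce
  then have one: "f (Short j) = 1" using short.prems(2) b(1) by simp
  have "f (Long j) = 0"
    using short.prems(4)[of j] b(4)[of j] k by fastforce
  then have "j = 1 \<or> f (Short (j - 1)) + f (Long (j - k)) = 1"
    using conserve[of j] b(1) short.prems(1) one by (cases "j = 1") (auto simp: net_flow_def)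
  then have "f e = 1" if "e \<in> p" for e
    using short.IH[OF _ _ _ _ that] short.prems(1,3,4) by fastforce
  then show ?case using one short.prems(5) by blast
next
  case (long j p)
  note b = dist_path_bounds[OF long.hyps k]
  have "f (Short (j + k - 1)) = 0"
    using long.prems(3)[of "j + k - 1"] b(1) b(3)[of "j + k - 1"] k by fastforce
  then have one: "f (Long j) = 1" using long.prems(2) b(1) k by simp
  have "f (Short j) = 0"
    using long.prems(3)[of j] b(3)[of j] k by fastforce
  then have "j = 1 \<or> f (Short (j - 1)) + f (Long (j - k)) = 1"
    using conserve[of j] b(1) long.prems(1) k one by (cases "j = 1") (auto simp: net_flow_def)
  then have "f e = 1" if "e \<in> p" for e
    using long.IH[OF _ _ _ _ that] long.prems(1,3,4) by fastforce
  then show ?case using one long.prems(5) by blast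
qed

section \<open>Extreme points are exactly the path flows\<close>

definition path_flow :: "dist_arc set \<Rightarrow> dist_arc \<Rightarrow>\<^sub>0 real" where
  "path_flow p = Abs_poly_mapping (indicator p)"

lemma lookup_path_flow:
  "finite p \<Longrightarrow> Poly_Mapping.lookup (path_flow p) = indicator p"
  unfolding path_flow_def by (rule lookup_Abs_poly_mapping) (simp add: indicator_def)

lemma lookup_scaleR:
  fixes f :: "'a \<Rightarrow>\<^sub>0 real"
  shows "Poly_Mapping.lookup (r *\<^sub>R f) e = r * Poly_Mapping.lookup f e"
proof -
  have "finite {i. r *\<^sub>R Poly_Mapping.lookup f i \<noteq> 0}"
    by (rule finite_subset[OF _ finite_lookup[of f]]) auto
  then show ?thesis by (simp add: scaleR_poly_mapping_def)
qed

lemma path_flow_in_flow_polytope: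
  assumes "dist_path k n p" "k \<ge> 1" "n \<ge> 2"
  shows "path_flow p \<in> flow_polytope (distance_graph k n)"
proof -
  have l: "Poly_Mapping.lookup (path_flow p) = indicator p"
    using dist_path_bounds(2)[OF assms(1,2)] by (rule lookup_path_flow)
  have "Poly_Mapping.keys (path_flow p) = p"
    by (auto simp: in_keys_iff l indicator_def)
  then show ?thesis
    using assms dist_path_subset_arcs[OF assms(1,2)] net_flow_indicator[OF assms(1,2)]
    by (auto simp: flow_polytope_distance_graph_iff l)
qed

lemma flow_supported_on_path_eq:
  assumes p: "dist_path k n p" and k: "k \<ge> 1" and n: "n \<ge> 2"
    and a: "a \<in> flow_polytope (distance_graph k n)" "Poly_Mapping.keys a \<subseteq> p"
  shows "a = path_flow p"
proof (rule poly_mapping_eqI)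
  fix e
  let ?a = "Poly_Mapping.lookup a"
  note b = dist_path_bounds[OF p k]
  have zero: "?a e = 0" if "e \<notin> p" for e
    using a(2) that by (meson in_keys_iff subsetD)
  have net: "net_flow k ?a i = (if i = 1 then 1 else if i = n then - 1 else 0)" if "i \<in> {1..n}" for i
    using a(1) k that by (simp add: flow_polytope_distance_graph_iff)
  \<comment> \<open>No arc of the path leaves \<open>n\<close>, so net flow -1 at \<open>n\<close>
    means inflow exactly 1.\<close>
  have "Short n \<notin> p" "Long n \<notin> p" using b(3)[of n] b(4)[of n] k by auto
  then have last: "?a (Short (n - 1)) + ?a (Long (n - k)) = 1"
    using net[of n] n zero by (simp add: net_flow_def)
  have "?a e = 1" if "e \<in> p"
  proof (rule flow_on_dist_path[OF p k order_refl _ _ _ _ that])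
    show "net_flow k ?a i = 0" if "1 < i" "i < n" for i
      using net[of i] that by simp
  qed (use last zero in auto)
  then show "?a e = Poly_Mapping.lookup (path_flow p) e"
    using zero[of e] by (simp add: lookup_path_flow[OF b(2)] indicator_def)
qed

lemma path_flow_extreme:
  assumes p: "dist_path k n p" and k: "k \<ge> 1" and n: "n \<ge> 2"
  shows "path_flow p extreme_point_of flow_polytope (distance_graph k n)"
  unfolding extreme_point_of_def
proof (intro conjI ballI notI)
  show "path_flow p \<in> flow_polytope (distance_graph k n)"
    using assms by (rule path_flow_in_flow_polytope)
next
  fix a b
  assume a: "a \<in> flow_polytope (distance_graph k n)"
    and b: "b \<in> flow_polytope (distance_graph k n)"
    and seg: "path_flow p \<in> open_segment a b"
  then obtain u where u: "0 < u" "u < 1" and eq: "path_flow p = (1 - u) *\<^sub>R a + u *\<^sub>R b"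
    by (auto simp: in_segment)
  \<comment> \<open>Off \<open>p\<close> two nonnegative values with positive weights sum to 0. Both
    endpoints of the segment are thus supported on \<open>p\<close>, where only one flow
    exists.\<close>
  have "Poly_Mapping.lookup a e = 0 \<and> Poly_Mapping.lookup b e = 0" if "e \<notin> p" for e
  proof -
    have "(1 - u) * Poly_Mapping.lookup a e + u * Poly_Mapping.lookup b e = 0"
      using arg_cong[OF eq, of "\<lambda>f. Poly_Mapping.lookup f e"] that
      by (simp add: lookup_path_flow dist_path_bounds(2)[OF p k] lookup_add lookup_scaleR)
    moreover have "0 \<le> (1 - u) * Poly_Mapping.lookup a e" "0 \<le> u * Poly_Mapping.lookup b e"
      using a b k u by (auto simp: flow_polytope_distance_graph_iff)
    ultimately have "(1 - u) * Poly_Mapping.lookup a e = 0" "u * Poly_Mapping.lookup b e = 0"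
      by linarith+
    then show ?thesis using u by simp
  qed
  then have "Poly_Mapping.keys a \<subseteq> p" "Poly_Mapping.keys b \<subseteq> p"
    by (auto simp: in_keys_iff)
  then have "a = b"
    using flow_supported_on_path_eq[OF p k n] a b by metis
  then show False using seg by simp
qed

lemma extreme_is_path_flow:
  assumes k: "k \<ge> 1" and n: "n \<ge> 2"
    and ext: "f extreme_point_of flow_polytope (distance_graph k n)"
  shows "\<exists>p. dist_path k n p \<and> f = path_flow p"
proof -
  let ?f = "Poly_Mapping.lookup f" and ?F = "flow_polytope (distance_graph k n)"
  have fF: "f \<in> ?F" using ext by (simp add: extreme_point_of_def)
  then have nonneg: "\<And>e. 0 \<le> ?f e"
    and keys: "Poly_Mapping.keys f \<subseteq> arcs (distance_graph k n)"
    and net: "\<And>i. i \<in> {1..n} \<Longrightarrow> net_flow k ?f i = (if i = 1 then 1 else if i = n then - 1 else 0)"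
    using k by (simp_all add: flow_polytope_distance_graph_iff)
  have supp: "e \<in> arcs (distance_graph k n)" if "?f e \<noteq> 0" for e
    using that keys by (meson in_keys_iff subsetD)
  \<comment> \<open>Inflow at \<open>n\<close> exceeds outflow by 1; this starts the backward
    walk.\<close>
  have "0 < ?f (Short (n - 1)) + ?f (Long (n - k))"
    using net[of n] n nonneg[of "Short n"] nonneg[of "Long n"] by (simp add: net_flow_def)
  then obtain p where p: "dist_path k n p" and pos: "\<And>e. e \<in> p \<Longrightarrow> 0 < ?f e"
    using dist_path_in_support[where f = ?f and j = n, OF k nonneg supp] net n by auto
  have fin: "finite p" using dist_path_bounds(2)[OF p k] .
  note l = lookup_path_flow[OF fin]
  have pF: "path_flow p \<in> ?F" using p k n by (rule path_flow_in_flow_polytope)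
  \<comment> \<open>Staying below every value on \<open>p\<close> keeps
    \<open>f - u *\<^sub>R path_flow p\<close> nonnegative; the bound 1/2 keeps \<open>1 - u\<close>
    positive.\<close>
  define u where "u = Min (insert (1 / 2) (?f ` p))"
  have u: "0 < u" "u \<le> 1 / 2" "\<And>e. e \<in> p \<Longrightarrow> u \<le> ?f e"
  proof -
    show "0 < u" using fin pos by (simp add: u_def)
    show "u \<le> 1 / 2" unfolding u_def by (rule Min_le) (use fin in simp_all)
    show "u \<le> ?f e" if "e \<in> p" for e
      unfolding u_def by (rule Min_le) (use fin that in simp_all)
  qed
  define g where "g = (1 / (1 - u)) *\<^sub>R (f - u *\<^sub>R path_flow p)"
  have lg: "Poly_Mapping.lookup g e = (?f e - u * indicator p e) / (1 - u)" for e
    by (simp add: g_def lookup_scaleR lookup_minus l)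
  have feq: "f = (1 - u) *\<^sub>R g + u *\<^sub>R path_flow p"
    using u by (simp add: g_def)
  have "g \<in> ?F"
    unfolding flow_polytope_distance_graph_iff[OF k]
  proof (intro conjI allI ballI)
    have "?f e \<noteq> 0" if "Poly_Mapping.lookup g e \<noteq> 0" for e
      using that pos[of e] by (cases "e \<in> p") (auto simp: lg)
    then show "Poly_Mapping.keys g \<subseteq> arcs (distance_graph k n)"
      using supp by (auto simp: in_keys_iff)
  next
    fix e show "0 \<le> Poly_Mapping.lookup g e"
      using u nonneg[of e] by (auto simp: lg indicator_def)
  next
    fix i assume i: "i \<in> {1..n}"
    have "net_flow k (Poly_Mapping.lookup g) i = (net_flow k ?f i - u * net_flow k (indicator p) i) / (1 - u)"
      by (simp add: net_flow_def lg add_divide_distrib diff_divide_distrib algebra_simps)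
    \<comment> \<open>Both flows send one unit from 1 to \<open>n\<close>, so dividing by
      \<open>1 - u\<close> restores the net flow after the subtraction.\<close>
    also have "net_flow k (indicator p) i = net_flow k ?f i"
      using net_flow_indicator[OF p k, of i] net[of i] i n by auto
    also have "(net_flow k ?f i - u * net_flow k ?f i) / (1 - u) = net_flow k ?f i"
      using u by (simp add: field_simps)
    finally show "net_flow k (Poly_Mapping.lookup g) i = (if i = 1 then 1 else if i = n then - 1 else 0)"
      using net[OF i] by simp
  qed
  then have "f \<notin> open_segment g (path_flow p)"
    using ext pF by (simp add: extreme_point_of_def)
  \<comment> \<open>The weights in \<open>feq\<close> lie strictly between 0 and 1, so distinct
    endpoints would put \<open>f\<close> in the open segment.\<close>
  then have "g = path_flow p"
    using feq u by (force simp: in_segment)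
  then have "f = path_flow p"
    using feq by (simp flip: scaleR_left_distrib)
  with p show ?thesis by blast
qed

section \<open>Counting paths\<close>

definition num_paths :: "nat \<Rightarrow> nat \<Rightarrow> nat" where
  "num_paths k n = card {p. dist_path k n p}"

lemma num_vertices_eq_num_paths:
  assumes "k \<ge> 1" "d \<ge> 1"
  shows "num_vertices k d = num_paths k (d + k)"
proof -
  have "{f. f extreme_point_of flow_polytope (distance_graph k (d + k))}
      = path_flow ` {p. dist_path k (d + k) p}"
    using assms path_flow_extreme[of k "d + k"] extreme_is_path_flow[of k "d + k"] by auto
  moreover have "inj_on path_flow {p. dist_path k (d + k) p}"
  proof (rule inj_onI)
    fix p q assume "p \<in> {p. dist_path k (d + k) p}" "q \<in> {p. dist_path k (d + k) p}"
      and eq: "path_flow p = path_flow q"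
    then have "finite p" "finite q" using assms(1) dist_path_bounds(2) by blast+
    then have "(indicator p :: dist_arc \<Rightarrow> real) = indicator q"
      using eq lookup_path_flow by metis
    then show "p = q" by (metis indicator_eq_1_iff subsetI subset_antisym)
  qed
  ultimately show ?thesis
    unfolding num_vertices_def num_paths_def by (simp add: card_image)
qed

text \<open>This value absorbs the truncated \<open>n - k\<close>, so the recursion below also holds
  when no long arc reaches \<open>n\<close>.\<close>

lemma num_paths_0:
  assumes "k \<ge> 1" shows "num_paths k 0 = 0"
proof -
  have "{p. dist_path k 0 p} = {}"
    using dist_path_bounds(1)[OF _ assms, of 0] by auto
  then show ?thesis by (simp add: num_paths_def)
qed

lemma finite_dist_paths:
  assumes "k \<ge> 1" shows "finite {p. dist_path k n p}"
proof (rule finite_subset)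
  show "{p. dist_path k n p} \<subseteq> Pow (arcs (distance_graph k n))"
    using dist_path_subset_arcs[OF _ assms] by blast
  show "finite (Pow (arcs (distance_graph k n)))"
    by (simp add: distance_graph_def)
qed

lemma num_paths_1:
  assumes "k \<ge> 1" shows "num_paths k 1 = 1"
proof -
  have "dist_path k 1 p \<longleftrightarrow> p = {}" for p
    using assms dist_path_bounds(1) dist_path.start
    by (subst dist_path.simps) fastforce
  then show ?thesis by (simp add: num_paths_def)
qed

lemma num_paths_rec:
  assumes k: "k \<ge> 1" and n: "n \<ge> 2"
  shows "num_paths k n = num_paths k (n - 1) + num_paths k (n - k)"
proof -
  let ?P = "\<lambda>n. {p. dist_path k n p}"
  let ?S = "Short (n - 1)" and ?L = "Long (n - k)"
  have S: "?S \<notin> p" if "dist_path k (n - 1) p" for p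
    using dist_path_bounds(3)[OF that k] by blast
  have L: "?L \<notin> p" if "dist_path k (n - k) p" for p
    using dist_path_bounds(4)[OF that k, of "n - k"] k by auto
  \<comment> \<open>This makes the two classes of paths disjoint, even for \<open>k = 1\<close>,
    where the two last arcs are parallel but have different names.\<close>
  have SL: "?S \<notin> p" if "dist_path k (n - k) p" for p
    using dist_path_bounds(3)[OF that k, of "n - 1"] k by auto
  have "?P n = insert ?S ` ?P (n - 1) \<union> insert ?L ` ?P (n - k)"
  proof (intro equalityI subsetI)
    fix p assume "p \<in> ?P n"
    then have "dist_path k n p" by simp
    then show "p \<in> insert ?S ` ?P (n - 1) \<union> insert ?L ` ?P (n - k)"
      using n by cases auto
  next
    fix p assume "p \<in> insert ?S ` ?P (n - 1) \<union> insert ?L ` ?P (n - k)"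
    then consider q where "p = insert ?S q" "dist_path k (n - 1) q"
      | q where "p = insert ?L q" "dist_path k (n - k) q" by blast
    then show "p \<in> ?P n"
    proof cases
      case 1
      then show ?thesis using dist_path.short[OF 1(2)] n by simp
    next
      case 2
      \<comment> \<open>A path ending at \<open>n - k\<close> forces this vertex to be at least 1,
        so the subtraction is exact.\<close>
      then show ?thesis
        using dist_path.long[OF 2(2)] dist_path_bounds(1)[OF 2(2) k] by simp
    qed
  qed
  moreover have "insert ?S ` ?P (n - 1) \<inter> insert ?L ` ?P (n - k) = {}"
    using SL by blast
  moreover have "inj_on (insert ?S) (?P (n - 1))" "inj_on (insert ?L) (?P (n - k))"
    using S L by (auto intro!: inj_onI dest: insert_ident[THEN iffD1, rotated 2])
  ultimately show ?thesis
    unfolding num_paths_def by (simp add: card_Un_disjoint finite_dist_paths[OF k] card_image)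
qed

lemma num_paths_small:
  assumes "1 \<le> n" "n \<le> k"
  shows "num_paths k n = 1"
  using assms
proof (induction n rule: dec_induct)
  case base
  then show ?case using num_paths_1 by simp
next
  case (step n)
  then show ?case using num_paths_rec[of k "Suc n"] num_paths_0[of k] by simp
qed

text \<open>From \<open>k\<close> on, each step of the recursion adds the count at a vertex with
  label at most \<open>k\<close>, which is 1.\<close>

lemma num_paths_medium:
  assumes "k \<ge> 1" "d \<le> k"
  shows "num_paths k (d + k) = d + 1"
  using assms(2)
proof (induction d)
  case 0
  then show ?case using num_paths_small assms(1) by simp
next
  case (Suc d)
  then show ?case
    using num_paths_rec[of k "Suc d + k"] num_paths_small[of "Suc d" k] assms(1) by simp
qed

section \<open>Vertex numbers and their generating function\<close>

lemma num_vertices_small: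
  assumes "k \<ge> 1" "d \<in> {1..k}"
  shows "num_vertices k d = d + 1"
  using assms num_vertices_eq_num_paths num_paths_medium by simp

text \<open>For \<open>d > k\<close> both \<open>d - 1\<close> and \<open>d - k\<close> are
  positive, so all three terms are path counts.\<close>

lemma num_vertices_rec:
  assumes "k \<ge> 1" "d > k"
  shows "num_vertices k d = num_vertices k (d - 1) + num_vertices k (d - k)"
  using assms num_paths_rec[of k "d + k"] by (simp add: num_vertices_eq_num_paths)

text \<open>Multiply by the denominator and compare coefficients: the initial values produce the
  numerator, and the recursion makes all coefficients beyond \<open>k\<close> vanish.\<close>

lemma fps_num_vertices:
  assumes k: "k \<ge> 1"
  shows "Abs_fps (\<lambda>d. if d \<ge> 1 then real (num_vertices k d) else 0)
      = fps_X * (2 + (\<Sum>i = 1..k - 1. fps_X ^ i)) / (1 - fps_X - fps_X ^ k)"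
    (is "?A = ?B / ?D")
proof -
  have "fps_nth (?A * ?D) n = fps_nth ?B n" for n
  proof -
    have two: "fps_nth (2 :: real fps) m = (if m = 0 then 2 else 0)" for m
      by (simp add: fps_numeral_nth)
    have sum_nth: "fps_nth (\<Sum>i = 1..k - 1. fps_X ^ i :: real fps) m = of_bool (1 \<le> m \<and> m \<le> k - 1)" for m
      by (simp add: fps_sum_nth)
    have lhs: "fps_nth (?A * ?D) n = fps_nth ?A n - (if n = 0 then 0 else fps_nth ?A (n - 1))
        - (if n < k then 0 else fps_nth ?A (n - k))"
      by (simp add: right_diff_distrib fps_X_power_mult_right_nth)
    consider "n = 0" | "1 \<le> n" "n \<le> k" | "n > k" by linarith
    then show ?thesis
    proof cases
      case 1
      then show ?thesis using k by (simp add: lhs)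
    next
      case 2
      \<comment> \<open>At \<open>n = 1\<close> the coefficient is the initial value 2; for larger
        \<open>n\<close> it is \<open>(n + 1) - n = 1\<close>. The \<open>fps_X ^ k\<close> term
        reaches only \<open>n = k\<close>, where it meets the zero constant coefficient.\<close>
      then show ?thesis
        unfolding lhs using num_vertices_small[OF k, of n] num_vertices_small[OF k, of "n - 1"] k
        by (auto simp: two sum_nth[unfolded One_nat_def])
    next
      case 3
      then show ?thesis
        unfolding lhs using num_vertices_rec[OF k 3] k by (auto simp: two sum_nth[unfolded One_nat_def])
    qed
  qed
  then have eq: "?A * ?D = ?B" by (rule fps_ext)
  \<comment> \<open>A nonzero denominator permits the cancellation that turns the product identity
    into the quotient.\<close>
  have "fps_nth ?D 0 = 1" using k by simp
  then have "?D \<noteq> 0" by (metis fps_zero_nth zero_neq_one)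
  then show ?thesis unfolding eq[symmetric] by simp
qed

theorem proposition6p1:
  fixes k :: nat
  assumes "k \<ge> 1"
  shows "(\<forall>d \<in> {1..k}. num_vertices k d = d + 1) \<and>
    (\<forall>d > k. num_vertices k d = num_vertices k (d - 1) + num_vertices k (d - k)) \<and>
    Abs_fps (\<lambda>d. if d \<ge> 1 then real (num_vertices k d) else 0)
      = fps_X * (2 + (\<Sum>i = 1..k - 1. fps_X ^ i)) / (1 - fps_X - fps_X ^ k)"
  using num_vertices_small[OF assms] num_vertices_rec[OF assms] fps_num_vertices[OF assms]
  by blast

end
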